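(* Let $\mathscr{A}$ be a finite set and let $\mathcal{F}_\mathscr{A}$ be the free semigroup over $\mathscr{A}$. If $S \subset \mathcal{F}_\mathscr{A}$ is product-free, then $d^*(S) \le 1/2$.
   Context: $\mathcal{F}_\mathscr{A}$ is the set of all finite nonempty words over the alphabet $\mathscr{A}$, with the associative operation $\cdot$ of concatenation. A set $S \subset \mathcal{F}_\mathscr{A}$ is product-free if there do not exist $x,y,z \in S$ (not necessarily distinct) with $x \cdot y = z$. For $n \in \mathbb{N}$, $\mathcal{F}(n)$ denotes the set of words of length $n$, and $d_S(n) = |S \cap \mathcal{F}(n)|/|\mathcal{F}(n)|$. The upper Banach density of $S$ is $d^*(S) = \limsup_{n-m \to \infty} \frac{\sum_{i=m}^{n} d_S(i)}{n-m+1}$. *)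

theory Defs
  imports Complex_Main "HOL-Library.Liminf_Limsup" "HOL-Library.Extended_Real"
begin

definition free_semigroup :: "'a set \<Rightarrow> 'a list set" where
  "free_semigroup A = lists A - {[]}"

definition words_of_length :: "'a set \<Rightarrow> nat \<Rightarrow> 'a list set" where
  "words_of_length A n = {w \<in> free_semigroup A. length w = n}"

definition product_free :: "'a list set \<Rightarrow> bool" where
  "product_free S \<longleftrightarrow> \<not> (\<exists>x\<in>S. \<exists>y\<in>S. \<exists>z\<in>S. x @ y = z)"

definition layer_density :: "'a set \<Rightarrow> 'a list set \<Rightarrow> nat \<Rightarrow> real" where
  "layer_density A S n =
     real (card (S \<inter> words_of_length A n)) / real (card (words_of_length A n))"

text \<open>
  The filter on pairs \<open>(m, n)\<close> is the one generated by the sets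
  \<open>{(m, n). 1 \<le> m \<and> N \<le> n - m}\<close>, which renders \<open>n - m \<rightarrow> \<infinity>\<close>. Truncated subtraction is
  harmless, since \<open>n - m \<ge> 1\<close> forces \<open>m < n\<close>. Indices start at 1 because words are
  nonempty. The value is an extended real because \<open>Limsup\<close> needs a complete lattice.
\<close>

definition upper_banach_density :: "'a set \<Rightarrow> 'a list set \<Rightarrow> ereal" where
  "upper_banach_density A S =
     Limsup (inf (filtercomap (\<lambda>(m, n). n - m) at_top) (principal {(m, n). 1 \<le> m}))
       (\<lambda>(m, n). ereal ((\<Sum>i=m..n. layer_density A S i) / (real n - real m + 1)))"

end

theory Submission
  imports Defs
begin

text \<open>
  Let \<open>T\<close> be the set of words of \<open>S\<close> without a proper prefix in \<open>S\<close>, and let \<open>t k\<close> and \<open>d k\<close> be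
  the layer densities of \<open>T\<close> and \<open>S\<close>. As \<open>T\<close> is a prefix code, \<open>\<Sum>k. t k \<le> 1\<close> (Kraft). Every
  word of \<open>S\<close> outside \<open>T\<close> is \<open>x @ y\<close> with \<open>x \<in> T\<close> and, by product-freeness, \<open>y \<notin> S\<close>. Hence
  \<open>d n \<le> t n + (\<Sum>k=1..<n. t k * (1 - d (n - k)))\<close>. Averaging over a long interval, on which
  a bounded shift is negligible, the mean \<open>D\<close> of \<open>d\<close> satisfies \<open>D \<le> 1 - D + o(1)\<close>.
\<close>

section \<open>Minimal words, and counting in layers\<close>

definition minimal_prefixes :: "'a list set \<Rightarrow> 'a list set" where
  "minimal_prefixes S = {x \<in> S. \<not> (\<exists>u\<in>S. \<exists>v. v \<noteq> [] \<and> x = u @ v)}"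

lemma minimal_prefixes_subset: "minimal_prefixes S \<subseteq> S"
  by (auto simp: minimal_prefixes_def)

lemma words_of_length_eq:
  assumes "n \<ge> 1"
  shows "words_of_length A n = {w. set w \<subseteq> A \<and> length w = n}"
  using assms by (auto simp: words_of_length_def free_semigroup_def)

lemma finite_words_of_length:
  assumes "finite A"
  shows "finite (words_of_length A n)"
  by (rule finite_subset[OF _ finite_lists_length_eq[OF assms, of n]])
     (auto simp: words_of_length_def free_semigroup_def)

lemma card_words_of_length:
  assumes "finite A" "n \<ge> 1"
  shows "card (words_of_length A n) = card A ^ n"
  using assms by (simp add: words_of_length_eq card_lists_length_eq)

lemma layer_density_nonneg: "0 \<le> layer_density A S n"
  by (simp add: layer_density_def)

lemma layer_density_le_1:
  assumes "finite A"
  shows "layer_density A S n \<le> 1"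
  using card_mono[OF finite_words_of_length[OF assms], of "S \<inter> words_of_length A n" n]
  by (auto simp: layer_density_def divide_le_eq_1)

text \<open>Without letters every layer is empty and the quotient is \<open>0 / 0 = 0\<close>. This
  settles the case in which one cannot divide by \<open>q ^ n\<close>.\<close>

lemma layer_density_empty_alphabet: "layer_density {} S n = 0"
  by (simp add: layer_density_def words_of_length_def free_semigroup_def)

lemma card_layer:
  assumes "finite A" "A \<noteq> {}" "n \<ge> 1"
  shows "real (card (S \<inter> words_of_length A n)) = layer_density A S n * real (card A) ^ n"
  using assms by (simp add: layer_density_def card_words_of_length)

lemma card_layer_Diff:
  assumes "finite A" "A \<noteq> {}" "n \<ge> 1"
  shows "real (card (words_of_length A n - S)) = (1 - layer_density A S n) * real (card A) ^ n"
proof -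
  have "card (words_of_length A n)
      = card (S \<inter> words_of_length A n) + card (words_of_length A n - S)"
    using card_Int_Diff[OF finite_words_of_length[OF assms(1)], of n S]
    by (simp add: Int_commute)
  then have "real (card A) ^ n
      = real (card (S \<inter> words_of_length A n)) + real (card (words_of_length A n - S))"
    using assms by (metis card_words_of_length of_nat_add of_nat_power)
  then show ?thesis
    using card_layer[OF assms, of S] by (simp add: algebra_simps)
qed

section \<open>Prefix codes and the Kraft inequality\<close>

text \<open>Replacing a non-minimal word by a proper prefix in \<open>S\<close> shortens it, so the
  descent stops.\<close>

lemma minimal_prefix_exists:
  assumes "z \<in> S"
  shows "\<exists>x\<in>minimal_prefixes S. \<exists>y. z = x @ y"
  using assms
proof (induction z rule: length_induct)
  case (1 z)
  show ?case
  proof (cases "z \<in> minimal_prefixes S")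
    case True
    then show ?thesis by (metis append_Nil2)
  next
    case False
    then obtain u v where "u \<in> S" "v \<noteq> []" "z = u @ v"
      using 1(2) by (auto simp: minimal_prefixes_def)
    moreover from this obtain x y where "x \<in> minimal_prefixes S" "u = x @ y"
      using 1(1)[rule_format, of u] by auto
    ultimately show ?thesis by auto
  qed
qed

text \<open>Two prefixes of one word are comparable; if they differed, the shorter would be a proper
  prefix in \<open>S\<close> of the longer.\<close>

lemma minimal_prefixes_unique:
  assumes "x \<in> minimal_prefixes S" "x' \<in> minimal_prefixes S" "x @ y = x' @ y'"
  shows "x = x'"
  using assms unfolding append_eq_append_conv2 minimal_prefixes_def by auto

text \<open>Extend each minimal word of length \<open>k\<close> to length \<open>n\<close> in all
  possible ways. The extensions of different minimal words are disjoint, and those of one word fill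
  a fraction \<open>1 / q ^ k\<close> of all words of length \<open>n\<close>.\<close>

lemma kraft_minimal_prefixes:
  assumes "finite A"
  shows "(\<Sum>k=1..n. layer_density A (minimal_prefixes S) k) \<le> 1"
proof (cases "A = {}")
  case True
  then show ?thesis by (simp add: layer_density_empty_alphabet)
next
  case False
  define q where "q = real (card A)"
  have q: "q > 0" using assms False by (simp add: q_def card_gt_0_iff)
  define T where "T k = minimal_prefixes S \<inter> words_of_length A k" for k
  \<comment> \<open>Unlike \<open>words_of_length A 0\<close>, the set \<open>W 0\<close> contains
    the empty word, which is the only extension when \<open>k = n\<close>.\<close>
  define W where "W k = {w. set w \<subseteq> A \<and> length w = k}" for k
  define P where "P = Sigma {1..n} (\<lambda>k. T k \<times> W (n - k))"
  have fin: "finite (T k)" "finite (W k)" for k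
    using finite_words_of_length[OF assms] finite_lists_length_eq[OF assms]
    by (auto simp: T_def W_def)
  have inj: "inj_on (\<lambda>(k, x, y). x @ y) P"
  proof -
    have "(k, x, y) = (k', x', y')"
      if *: "(k, x, y) \<in> P" "(k', x', y') \<in> P" "x @ y = x' @ y'" for k x y k' x' y'
    proof -
      have "x = x'"
        by (rule minimal_prefixes_unique[of x S x' y y']) (use * in \<open>auto simp: P_def T_def\<close>)
      with * show ?thesis
        by (auto simp: P_def T_def words_of_length_def)
    qed
    then show ?thesis by (auto intro!: inj_onI)
  qed
  have "(\<lambda>(k, x, y). x @ y) ` P \<subseteq> W n"
    by (auto simp: P_def T_def W_def words_of_length_def free_semigroup_def)
  then have "card P \<le> card (W n)"
    using inj fin(2) card_inj_on_le by blast
  also have "card P = (\<Sum>k=1..n. card (T k) * card (W (n - k)))"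
    using fin by (simp add: P_def card_cartesian_product)
  finally have "(\<Sum>k=1..n. real (card (T k)) * real (card (W (n - k)))) \<le> real (card (W n))"
    by (metis (mono_tags, lifting) of_nat_le_iff of_nat_mult of_nat_sum sum.cong)
  moreover have "real (card (T k)) * real (card (W (n - k)))
      = layer_density A (minimal_prefixes S) k * q ^ n" if "k \<in> {1..n}" for k
    using that card_layer[OF assms False, of k "minimal_prefixes S"]
    by (simp add: T_def W_def card_lists_length_eq[OF assms] q_def flip: power_add)
  ultimately have "(\<Sum>k=1..n. layer_density A (minimal_prefixes S) k) * q ^ n \<le> q ^ n"
    by (simp add: sum_distrib_right W_def card_lists_length_eq[OF assms] q_def)
  then show ?thesis using q by simp
qed

section \<open>The recursive inequality from product-freeness\<close>

lemma layer_density_recursive_bound: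
  assumes "finite A" "S \<subseteq> free_semigroup A" "product_free S" "n \<ge> 1"
  shows "layer_density A S n \<le> layer_density A (minimal_prefixes S) n
    + (\<Sum>k=1..<n. layer_density A (minimal_prefixes S) k * (1 - layer_density A S (n - k)))"
proof (cases "A = {}")
  case True
  then show ?thesis by (simp add: layer_density_empty_alphabet)
next
  case False
  define q where "q = real (card A)"
  have q: "q > 0" using assms False by (simp add: q_def card_gt_0_iff)
  let ?F = "words_of_length A" and ?M = "minimal_prefixes S"
  define T where "T k = ?M \<inter> ?F k" for k
  \<comment> \<open>Candidates for words of \<open>S\<close> whose minimal prefix has length
    \<open>k < n\<close>: the nonempty remainder must avoid \<open>S\<close>. Only an upper bound on
    the size of \<open>R k\<close> is needed, so injectivity of concatenation is not
    checked.\<close>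
  define R where "R k = (\<lambda>(x, y). x @ y) ` (T k \<times> (?F (n - k) - S))" for k
  have fin: "finite (T k)" "finite (?F k)" for k
    using finite_words_of_length[OF assms(1)] by (auto simp: T_def)
  have "S \<inter> ?F n \<subseteq> T n \<union> (\<Union>k\<in>{1..<n}. R k)"
  proof
    fix z assume z: "z \<in> S \<inter> ?F n"
    then obtain x y where xy: "x \<in> ?M" "z = x @ y"
      using minimal_prefix_exists by blast
    have xS: "x \<in> S" using xy minimal_prefixes_subset by blast
    show "z \<in> T n \<union> (\<Union>k\<in>{1..<n}. R k)"
    proof (cases "y = []")
      case True
      then show ?thesis using z xy by (simp add: T_def)
    next
      case False
      have "y \<notin> S" using z xy xS assms(3) by (auto simp: product_free_def)
      moreover have "x \<in> ?F (length x)" "y \<in> ?F (n - length x)" "length x \<in> {1..<n}"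
        using z xy xS assms(2) False
        by (auto simp: words_of_length_def free_semigroup_def Suc_le_eq)
      ultimately have "z \<in> R (length x)"
        using xy by (auto simp: R_def T_def)
      with \<open>length x \<in> {1..<n}\<close> show ?thesis by blast
    qed
  qed
  then have "card (S \<inter> ?F n) \<le> card (T n \<union> (\<Union>k\<in>{1..<n}. R k))"
    by (rule card_mono[rotated]) (use fin in \<open>auto simp: R_def\<close>)
  also have "\<dots> \<le> card (T n) + card (\<Union>k\<in>{1..<n}. R k)"
    by (rule card_Un_le)
  also have "\<dots> \<le> card (T n) + (\<Sum>k=1..<n. card (R k))"
    by (intro add_left_mono card_UN_le) simp
  also have "\<dots> \<le> card (T n) + (\<Sum>k=1..<n. card (T k) * card (?F (n - k) - S))"
    unfolding R_def using fin
    by (intro add_left_mono sum_mono)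
       (metis card_cartesian_product card_image_le finite_Diff finite_cartesian_product)
  finally have "real (card (S \<inter> ?F n))
      \<le> real (card (T n)) + (\<Sum>k=1..<n. real (card (T k)) * real (card (?F (n - k) - S)))"
    by (simp flip: of_nat_mult of_nat_sum of_nat_add)
  moreover have "real (card (T k)) * real (card (?F (n - k) - S))
      = layer_density A ?M k * (1 - layer_density A S (n - k)) * q ^ n" if "k \<in> {1..<n}" for k
    using that card_layer[OF assms(1) False, of k ?M] card_layer_Diff[OF assms(1) False, of "n - k" S]
    by (simp add: T_def q_def Suc_le_eq ac_simps flip: power_add)
  ultimately have "layer_density A S n * q ^ n \<le> (layer_density A ?M n
    + (\<Sum>k=1..<n. layer_density A ?M k * (1 - layer_density A S (n - k)))) * q ^ n"
    using card_layer[OF assms(1) False assms(4)]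
    by (simp add: T_def q_def sum_distrib_right distrib_right)
  then show ?thesis using q by simp
qed

section \<open>Averaging over intervals\<close>

text \<open>Moving the window down by \<open>k\<close> brings in at most \<open>k\<close> new
  indices, all below \<open>m\<close>. Restricting to \<open>i > k\<close> keeps
  \<open>i - k\<close> from being truncated.\<close>

lemma sum_shift_le:
  fixes f :: "nat \<Rightarrow> real"
  assumes "\<And>i. 0 \<le> f i" "\<And>i. f i \<le> 1"
  shows "(\<Sum>i\<in>{m..n} \<inter> {k<..}. f (i - k)) \<le> (\<Sum>i=m..n. f i) + real k"
proof -
  let ?I = "{m..n} \<inter> {k<..}"
  have "(\<Sum>i\<in>?I. f (i - k)) = (\<Sum>j\<in>(\<lambda>i. i - k) ` ?I. f j)"
    by (rule sum.reindex[symmetric, unfolded o_def]) (auto simp: inj_on_def)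
  also have "\<dots> \<le> (\<Sum>j\<in>{m..n} \<union> {m - k..<m}. f j)"
    by (rule sum_mono2) (use assms in auto)
  also have "\<dots> = (\<Sum>j=m..n. f j) + (\<Sum>j=m-k..<m. f j)"
    by (rule sum.union_disjoint) auto
  also have "(\<Sum>j=m-k..<m. f j) \<le> real (card {m-k..<m}) * 1"
    by (rule sum_bounded_above) (use assms in auto)
  also have "\<dots> \<le> real k" by simp
  finally show ?thesis by simp
qed

text \<open>With \<open>L\<close> the length of the interval and \<open>D\<close> the sum of
  \<open>d\<close> over it, shifts up to \<open>K\<close> have total weight at most 1 and give at
  most \<open>L - D + K\<close>; longer shifts have weight at most \<open>\<eta>\<close> and give at
  most \<open>\<eta> * L\<close>. So \<open>D \<le> 1 + (L - D + K) + \<eta> * L\<close>.\<close>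

lemma recursive_bound_interval_sum:
  fixes d t :: "nat \<Rightarrow> real"
  assumes d: "\<And>i. 0 \<le> d i" "\<And>i. d i \<le> 1" and t: "\<And>i. 0 \<le> t i"
    and kraft: "\<And>n. (\<Sum>k=1..n. t k) \<le> 1"
    and rec: "\<And>n. n \<ge> 1 \<Longrightarrow> d n \<le> t n + (\<Sum>k=1..<n. t k * (1 - d (n - k)))"
    and tail: "\<And>n. (\<Sum>k\<in>{K<..n}. t k) \<le> \<eta>"
    and mn: "1 \<le> m" "m \<le> n"
  shows "2 * (\<Sum>i=m..n. d i) \<le> (1 + \<eta>) * (real n - real m + 1) + 1 + real K"
proof -
  define L where "L = real n - real m + 1"
  define D where "D = (\<Sum>i=m..n. d i)"
  \<comment> \<open>The coefficient of \<open>t k\<close> once the double sum is swapped.\<close>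
  define G where "G k = (\<Sum>i\<in>{m..n} \<inter> {k<..}. 1 - d (i - k))" for k
  have L: "L = real (card {m..n})" using mn by (simp add: L_def of_nat_diff)
  have compl: "(\<Sum>i=m..n. 1 - d i) = L - D"
    by (simp add: sum_subtractf L D_def)
  have LD: "0 \<le> L - D"
    unfolding compl[symmetric] by (intro sum_nonneg) (simp add: d)
  have G0: "0 \<le> G k" for k
    unfolding G_def by (intro sum_nonneg) (simp add: d)
  have G_near: "G k \<le> L - D + real k" for k
    using sum_shift_le[of "\<lambda>i. 1 - d i" k m n] d compl by (simp add: G_def)
  have G_far: "G k \<le> L" for k
  proof -
    have "G k \<le> real (card ({m..n} \<inter> {k<..})) * 1"
      unfolding G_def by (rule sum_bounded_above) (simp add: d)
    also have "\<dots> \<le> L" unfolding L by (simp del: card_atLeastAtMost add: card_mono)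
    finally show ?thesis .
  qed
  have "D \<le> (\<Sum>i=m..n. t i + (\<Sum>k=1..<i. t k * (1 - d (i - k))))"
    unfolding D_def by (intro sum_mono rec) (use mn in auto)
  also have "\<dots> = (\<Sum>i=m..n. t i) + (\<Sum>i=m..n. \<Sum>k=1..<i. t k * (1 - d (i - k)))"
    by (rule sum.distrib)
  \<comment> \<open>Writing \<open>k < i\<close> as a side condition makes the range of
    \<open>k\<close> independent of \<open>i\<close>, as the swap requires.\<close>
  also have "(\<Sum>i=m..n. \<Sum>k=1..<i. t k * (1 - d (i - k)))
      = (\<Sum>i=m..n. \<Sum>k | k \<in> {1..n} \<and> k < i. t k * (1 - d (i - k)))"
    by (intro sum.cong) auto
  also have "\<dots> = (\<Sum>k=1..n. \<Sum>i | i \<in> {m..n} \<and> k < i. t k * (1 - d (i - k)))"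
    by (rule sum.swap_restrict) auto
  also have "\<dots> = (\<Sum>k=1..n. t k * G k)"
    unfolding G_def sum_distrib_left by (intro sum.cong) auto
  also have "(\<Sum>i=m..n. t i) \<le> (\<Sum>i=1..n. t i)"
    by (rule sum_mono2) (use mn t in auto)
  also have "\<dots> \<le> 1" by (rule kraft)
  \<comment> \<open>An inequality only, since \<open>K\<close> may exceed \<open>n\<close>.\<close>
  also have "(\<Sum>k=1..n. t k * G k) \<le> (\<Sum>k\<in>{1..K} \<union> {K<..n}. t k * G k)"
    by (rule sum_mono2) (use t G0 in auto)
  also have "\<dots> = (\<Sum>k=1..K. t k * G k) + (\<Sum>k\<in>{K<..n}. t k * G k)"
    by (rule sum.union_disjoint) auto
  also have "(\<Sum>k=1..K. t k * G k) \<le> (\<Sum>k=1..K. t k * (L - D + real K))"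
  proof (intro sum_mono mult_left_mono t)
    fix k assume "k \<in> {1..K}"
    then show "G k \<le> L - D + real K" using G_near[of k] by simp
  qed
  also have "\<dots> \<le> 1 * (L - D + real K)"
    unfolding sum_distrib_right[symmetric] using LD by (intro mult_right_mono kraft) auto
  also have "(\<Sum>k\<in>{K<..n}. t k * G k) \<le> (\<Sum>k\<in>{K<..n}. t k * L)"
    by (intro sum_mono mult_left_mono t G_far)
  also have "\<dots> \<le> \<eta> * L"
    unfolding sum_distrib_right[symmetric] using L by (intro mult_right_mono tail) auto
  finally show ?thesis unfolding D_def[symmetric] L_def[symmetric] by (simp add: algebra_simps)
qed

text \<open>Take \<open>K\<close> with partial sum within \<open>\<eta>\<close> of the supremum;
  later partial sums cannot pass the supremum.\<close>

lemma bounded_partial_sums_small_tail: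
  fixes t :: "nat \<Rightarrow> real"
  assumes t: "\<And>i. 0 \<le> t i" and bound: "\<And>n. (\<Sum>k=1..n. t k) \<le> B" and "\<eta> > 0"
  obtains K where "\<And>n. (\<Sum>k\<in>{K<..n}. t k) \<le> \<eta>"
proof -
  define s where "s n = (\<Sum>k=1..n. t k)" for n
  have bdd: "bdd_above (range s)"
    using bound by (auto simp: s_def intro!: bdd_aboveI[of _ B])
  obtain K where K: "Sup (range s) - \<eta> < s K"
    using less_cSup_iff[OF _ bdd, of "Sup (range s) - \<eta>"] \<open>\<eta> > 0\<close> by auto
  have "(\<Sum>k\<in>{K<..n}. t k) \<le> \<eta>" for n
  proof (cases "K \<le> n")
    case True
    have "{1..n} = {1..K} \<union> {K<..n}" "{1..K} \<inter> {K<..n} = {}" using True by auto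
    then have "s n = s K + (\<Sum>k\<in>{K<..n}. t k)"
      unfolding s_def by (simp add: sum.union_disjoint)
    moreover have "s n \<le> Sup (range s)" using bdd by (intro cSup_upper) auto
    ultimately show ?thesis using K by simp
  qed (use \<open>\<eta> > 0\<close> in simp)
  then show ?thesis using that by blast
qed

theorem theorem1:
  fixes A :: "'a set" and S :: "'a list set"
  assumes "finite A"
    and "S \<subseteq> free_semigroup A"
    and "product_free S"
  shows "upper_banach_density A S \<le> ereal (1 / 2)"
proof (rule ereal_le_epsilon2)
  fix e :: real assume e: "e > 0"
  let ?d = "layer_density A S" and ?t = "layer_density A (minimal_prefixes S)"
  obtain K where K: "\<And>n. (\<Sum>k\<in>{K<..n}. ?t k) \<le> e"
    using bounded_partial_sums_small_tail[OF layer_density_nonneg kraft_minimal_prefixes[OF assms(1)] e]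
    by blast
  \<comment> \<open>On intervals of length at least \<open>N\<close> the constant error
    \<open>1 + K\<close> is at most \<open>e\<close> times the length. Together with the tail error
    this gives \<open>2 * e\<close>, hence \<open>e\<close> after halving.\<close>
  obtain N :: nat where N: "real N \<ge> (1 + real K) / e"
    using real_arch_simple by blast
  have "(\<Sum>i=m..n. ?d i) / (real n - real m + 1) \<le> 1 / 2 + e"
    if "1 \<le> m" "n - m \<ge> Suc N" for m n
  proof -
    let ?L = "real n - real m + 1"
    have mn: "m \<le> n" and L: "?L \<ge> real N" "?L > 0" using that by linarith+
    have "1 + real K \<le> e * ?L"
      using N L e by (simp add: divide_le_eq mult.commute) (smt (verit) mult_left_mono)
    moreover have "2 * (\<Sum>i=m..n. ?d i) \<le> (1 + e) * ?L + 1 + real K"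
      by (rule recursive_bound_interval_sum[where t = ?t])
         (use layer_density_nonneg layer_density_le_1 kraft_minimal_prefixes
            layer_density_recursive_bound assms K that mn in auto)
    ultimately have "(\<Sum>i=m..n. ?d i) \<le> (1 / 2 + e) * ?L"
      by (simp add: algebra_simps add_divide_distrib)
    then show ?thesis using L(2) by (simp add: pos_divide_le_eq)
  qed
  \<comment> \<open>The witness for \<open>filtercomap\<close> is a predicate on the difference
    \<open>n - m\<close> alone; \<open>1 \<le> m\<close> comes from the principal filter.\<close>
  then have "upper_banach_density A S \<le> ereal (1 / 2 + e)"
    unfolding upper_banach_density_def
    by (intro Limsup_bounded)
       (auto simp: eventually_inf_principal eventually_filtercomap
         intro!: exI[of _ "\<lambda>x. Suc N \<le> x"] eventually_ge_at_top)
  then show "upper_banach_density A S \<le> ereal (1 / 2) + ereal e" by simp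
qed

end
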